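(* Let $u\in C_{c,+}(\mathbb R^3;\mathbb R)$, $T\in C(\mathbb R;\mathbb R^3)$, $R\in C^2(\mathbb R;SO(3))$, let $\omega\in C^1(\mathbb R;\mathbb R^3)$ be the angular velocity associated with $R$, with cylindrical radius $\alpha$, cylindrical component $v$ and third component $\omega_3$, and let $\tilde{\mathcal J}$ be the reduced attenuation map of $u$ under the motion $(T,R)$. Then for all $t\in\mathbb R$ with $\alpha(t)\neq 0$ and all $\mu\in\mathbb R$, $$\partial_t\tilde{\mathcal J}(t,\mu v(t))=\omega_3(t)\,\mathbf D^1[\tilde{\mathcal J}](t,\mu v(t))[\![\mu v^\perp(t)]\!],$$ where $\partial_t\tilde{\mathcal J}$ denotes the partial derivative of $\tilde{\mathcal J}$ with respect to its first argument.
   Context: $C_{c,+}(\mathbb R^3;\mathbb R)=\{u\in C(\mathbb R^3;\mathbb R)\mid \operatorname{supp}(u)\neq\emptyset\text{ is compact},\ u\ge 0\}$. The center of $u$ is $\mathcal C_3:=\frac{1}{\int_{\mathbb R^3}u}\int_{\mathbb R^3}x\,u(x)\,dx$. The attenuation mapping of $u$ under a rigid motion $(T,R)$ is $$\mathcal J[T,R](t,x_1,x_2)=\int_{-\infty}^{\infty}u\big(\mathcal C_3+R(t)(x-\mathcal C_3+T(t))\big)\,dx_3,\qquad x=(x_1,x_2,x_3)^T.$$ Its two-dimensional center is $\mathcal C_2(t):=\frac{1}{\int_{\mathbb R^2}\mathcal J[T,R](t,x)\,dx}\int_{\mathbb R^2}x\,\mathcal J[T,R](t,x)\,dx\in\mathbb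 R^2$. With the Fourier transform convention $\mathcal F_2[f](k)=(2\pi)^{-1}\int_{\mathbb R^2}f(x)e^{-\mathrm i\langle k,x\rangle}\,dx$ (applied in the variables $(x_1,x_2)$), the reduced attenuation map is the (complex-valued) function $$\tilde{\mathcal J}(t,k)=\mathcal F_2[\mathcal J[T,R]](t,k)\,e^{\mathrm i\langle k,\mathcal C_2(t)\rangle},\qquad (t,k)\in\mathbb R\times\mathbb R^2.$$ The angular velocity $\omega$ of $R\in C^1(\mathbb R;SO(3))$ is defined by $R(t)^TR'(t)x=\omega(t)\times x$ for all $x\in\mathbb R^3$. It is written in cylindrical coordinates with axis $e_3$ as $$\omega(t)=\begin{pmatrix}\alpha(t)v(t)\\ \omega_3(t)\end{pmatrix}=\begin{pmatrix}\alpha(t)\cos\varphi(t)\\ \alpha(t)\sin\varphi(t)\\ \omega_3(t)\end{pmatrix},$$ with continuous $\alpha:\mathbb R\to[0,\infty)$ (cylindrical radius), $v:\mathbb R\to\mathbb S^1\subset\mathbb R^2$ (cylindrical component) and $\varphi:\mathbb R\to\mathbb R$ (cylindrical angle); $v^\perp(t)=(-v_2(t),v_1(t))^T$. For $f:\mathbb R\times\mathbb R^2\to\mathbb C$, $\mathbf D^i[f](t,\kappa)[\![w_1,\dots,w_i]\!]$ denotes the $i$-th derivative tensor of $k\mapsto f(t,k)$ (for fixed $t$) at the point $\kappa\in\mathbb R^2$, evaluated at the vectors $w_1,\dots,w_i\in\mathbb R^2$; in particular $\mathbf D^1[f](t,\kappa)[\![w]\!]=\nabla_kf(t,\kappa)\cdot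 w$. *)

theory Defs
  imports "HOL-Analysis.Analysis"
begin

definition C_c_plus :: "(real^3 \<Rightarrow> real) set" where
  "C_c_plus = {u. continuous_on UNIV u \<and>
     closure (support_on UNIV u) \<noteq> {} \<and> compact (closure (support_on UNIV u)) \<and>
     (\<forall>x. u x \<ge> 0)}"

primrec Ck :: "nat \<Rightarrow> (real \<Rightarrow> 'a::real_normed_vector) \<Rightarrow> bool" where
  "Ck 0 f \<longleftrightarrow> continuous_on UNIV f"
| "Ck (Suc n) f \<longleftrightarrow> (\<forall>t. f differentiable (at t)) \<and> Ck n (\<lambda>t. vector_derivative f (at t))"

definition center3 :: "(real^3 \<Rightarrow> real) \<Rightarrow> real^3" where
  "center3 u = (1 / (LINT x|lborel. u x)) *\<^sub>R (LINT x|lborel. u x *\<^sub>R x)"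

definition attenuation ::
  "(real^3 \<Rightarrow> real) \<Rightarrow> (real \<Rightarrow> real^3) \<Rightarrow> (real \<Rightarrow> real^3^3) \<Rightarrow> real \<Rightarrow> real^2 \<Rightarrow> real" where
  "attenuation u T R t x =
     (LINT x3|lborel. u (center3 u + R t *v (vector [x $ 1, x $ 2, x3] - center3 u + T t)))"

definition center2 ::
  "(real^3 \<Rightarrow> real) \<Rightarrow> (real \<Rightarrow> real^3) \<Rightarrow> (real \<Rightarrow> real^3^3) \<Rightarrow> real \<Rightarrow> real^2" where
  "center2 u T R t = (1 / (LINT x|lborel. attenuation u T R t x)) *\<^sub>R
     (LINT x|lborel. attenuation u T R t x *\<^sub>R x)"

definition fourier2 :: "(real^2 \<Rightarrow> complex) \<Rightarrow> real^2 \<Rightarrow> complex" where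
  "fourier2 f k =
     complex_of_real (1 / (2 * pi)) * (LINT x|lborel. f x * exp (- (\<i> * complex_of_real (k \<bullet> x))))"

definition reduced_attenuation ::
  "(real^3 \<Rightarrow> real) \<Rightarrow> (real \<Rightarrow> real^3) \<Rightarrow> (real \<Rightarrow> real^3^3) \<Rightarrow> real \<Rightarrow> real^2 \<Rightarrow> complex" where
  "reduced_attenuation u T R t k =
     fourier2 (\<lambda>x. complex_of_real (attenuation u T R t x)) k *
     exp (\<i> * complex_of_real (k \<bullet> center2 u T R t))"

definition is_angular_velocity :: "(real \<Rightarrow> real^3^3) \<Rightarrow> (real \<Rightarrow> real^3) \<Rightarrow> bool" where
  "is_angular_velocity R \<omega> \<longleftrightarrow>
     (\<forall>t x. (transpose (R t) ** vector_derivative R (at t)) *v x = cross3 (\<omega> t) x)"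

text \<open>Continuity is required of the radius, the component and the angle on the whole real line.
  Where the radius vanishes, the component \<open>v\<close> and the angle \<open>\<phi>\<close> are not determined
  by \<open>\<omega>\<close>.\<close>

definition cylindrical_coordinates ::
  "(real \<Rightarrow> real^3) \<Rightarrow> (real \<Rightarrow> real) \<Rightarrow> (real \<Rightarrow> real^2) \<Rightarrow> (real \<Rightarrow> real) \<Rightarrow> (real \<Rightarrow> real) \<Rightarrow> bool"
where
  "cylindrical_coordinates \<omega> \<alpha> v \<phi> \<omega>3 \<longleftrightarrow>
     continuous_on UNIV \<alpha> \<and> continuous_on UNIV v \<and> continuous_on UNIV \<phi> \<and>
     (\<forall>t. \<alpha> t \<ge> 0 \<and> norm (v t) = 1 \<and>
        \<omega> t = vector [\<alpha> t * v t $ 1, \<alpha> t * v t $ 2, \<omega>3 t] \<and>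
        \<omega> t = vector [\<alpha> t * cos (\<phi> t), \<alpha> t * sin (\<phi> t), \<omega>3 t])"

definition perp :: "real^2 \<Rightarrow> real^2" where
  "perp w = vector [- (w $ 2), w $ 1]"

text \<open>The first derivative tensor in the spatial variable; the derivative is the real
  Frechet derivative, also for complex-valued functions. As \<^const>\<open>frechet_derivative\<close> is
  unspecified at points of non-differentiability, statements about \<open>D1\<close> should be accompanied
  by differentiability of \<open>f t\<close> at \<open>\<kappa>\<close>.\<close>

definition D1 :: "(real \<Rightarrow> real^2 \<Rightarrow> complex) \<Rightarrow> real \<Rightarrow> real^2 \<Rightarrow> real^2 \<Rightarrow> complex" where
  "D1 f t \<kappa> w = frechet_derivative (f t) (at \<kappa>) w"

end

theory Submission
  imports Defs
begin

text \<open>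
  Substituting the rigid motion in the integral over \<open>\<real>\<^sup>3\<close> gives the centre
  \<open>C\<^sub>2(t) = P(C\<^sub>3 - T(t))\<close> with \<open>P\<close> the projection to the first two coordinates. The phase
  factor of the reduced attenuation map therefore removes the translation, and
  \<open>J(t, k) = \<Phi>(R(t)(k, 0))\<close> where
  \<open>\<Phi>(\<xi>) = (1 / 2\<pi>) \<integral> u(y) exp(-i \<xi> \<bullet> (y - C\<^sub>3)) dy\<close> is differentiable. At \<open>k = \<mu> v(t)\<close>,
  \<open>R'(t)(k, 0) = R(t)(\<omega>(t) \<times> (\<mu> v(t), 0)) = \<omega>\<^sub>3(t) R(t)(\<mu> v\<^sup>\<bottom>(t), 0)\<close>, because the horizontal
  part of \<open>\<omega>(t)\<close> is parallel to \<open>v(t)\<close>; the chain rule yields the identity.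
\<close>

section \<open>Lebesgue measure under rigid motions and the splitting of space\<close>

text \<open>A Borel measure with the right value on every box is \<open>lborel\<close>. The preimage
  of a box under \<open>A\<close> is its image under the orthogonal \<open>transpose A\<close>,
  which preserves volume.\<close>

lemma distr_lborel_orthogonal_matrix:
  fixes A :: "real^'n::{finite,wellorder}^'n::{finite,wellorder}"
  assumes "orthogonal_matrix A"
  shows "distr lborel borel ((*v) A) = lborel"
proof (rule lborel_eqI[symmetric])
  fix l u :: "real^'n::{finite,wellorder}"
  assume lu: "\<And>b. b \<in> Basis \<Longrightarrow> l \<bullet> b \<le> u \<bullet> b"
  have meas [measurable]: "(*v) A \<in> borel_measurable lborel"
    by (simp add: matrix_vector_mul_linear linear_continuous_on linear_linear borel_measurable_continuous_onI)
  have ort: "orthogonal_transformation ((*v) (transpose A))"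
    using assms by (simp add: orthogonal_matrix_transpose orthogonal_transformation_matrix)
  have eq: "(*v) A -` box l u = (*v) (transpose A) ` box l u"
    using assms unfolding orthogonal_matrix_def
    by (auto simp: image_iff matrix_vector_mul_assoc simp del: transpose_matrix_vector intro!: bexI[of _ "A *v _"])
  have m: "(*v) A -` box l u \<in> sets lborel"
    using measurable_sets[OF meas, of "box l u"] by simp
  have "emeasure (distr lborel borel ((*v) A)) (box l u) = emeasure lborel ((*v) A -` box l u)"
    by (simp add: emeasure_distr)
  \<comment> \<open>The preimage is Borel, so \<open>lborel\<close> and its completion agree on it;
    the volume results for orthogonal images concern the completion.\<close>
  also have "\<dots> = emeasure lebesgue ((*v) (transpose A) ` box l u)"
    unfolding eq[symmetric] using m by simp
  also have "\<dots> = ennreal (measure lebesgue ((*v) (transpose A) ` box l u))"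
    by (intro emeasure_eq_measure2 measurable_orthogonal_image ort) auto
  also have "\<dots> = ennreal (measure lebesgue (box l u))"
    by (subst measure_orthogonal_image[OF ort]) auto
  also have "\<dots> = (\<Prod>b\<in>Basis. (u - l) \<bullet> b)"
    using lu by (simp add: inner_diff_left)
  finally show "emeasure (distr lborel borel ((*v) A)) (box l u) = (\<Prod>b\<in>Basis. (u - l) \<bullet> b)" .
qed simp

lemma distr_lborel_rigid_motion:
  fixes A :: "real^'n::{finite,wellorder}^'n::{finite,wellorder}"
  assumes "orthogonal_matrix A"
  shows "distr lborel borel (\<lambda>x. b + A *v x) = lborel"
proof -
  have "(*v) A \<in> borel_measurable lborel"
    by (simp add: matrix_vector_mul_linear linear_continuous_on linear_linear borel_measurable_continuous_onI)
  then have "distr lborel borel (\<lambda>x. b + A *v x) = distr (distr lborel borel ((*v) A)) borel ((+) b)"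
    by (subst distr_distr) (auto simp: comp_def)
  also have "\<dots> = lborel"
    using distr_lborel_orthogonal_matrix[OF assms] by (simp add: lborel_distr_plus)
  finally show ?thesis .
qed

lemma prod_Basis_cart: "(\<Prod>b\<in>Basis. (x::real^'n) \<bullet> b) = (\<Prod>i\<in>UNIV. x $ i)"
proof -
  have "(Basis :: (real^'n) set) = (\<lambda>i. axis i 1) ` UNIV"
    by (auto simp: Basis_vec_def)
  then have "(\<Prod>b\<in>Basis. x \<bullet> b) = (\<Prod>b\<in>range (\<lambda>i. axis i 1). x \<bullet> b)"
    by (rule arg_cong)
  also have "\<dots> = (\<Prod>i\<in>UNIV. x \<bullet> axis i 1)"
    by (subst prod.reindex) (auto simp: inj_on_def axis_eq_axis)
  finally show ?thesis
    by (simp add: inner_axis)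
qed

lemma continuous_on_vector_3 [continuous_intros]:
  fixes f g h :: "'a::topological_space \<Rightarrow> real"
  assumes "continuous_on S f" "continuous_on S g" "continuous_on S h"
  shows "continuous_on S (\<lambda>x. vector [f x, g x, h x] :: real^3)"
proof -
  have "continuous_on S (\<lambda>x. f x *\<^sub>R axis 1 1 + g x *\<^sub>R axis 2 1 + h x *\<^sub>R axis 3 1 :: real^3)"
    by (intro continuous_intros assms)
  moreover have "f x *\<^sub>R axis 1 1 + g x *\<^sub>R axis 2 1 + h x *\<^sub>R axis 3 1 = (vector [f x, g x, h x] :: real^3)" for x
    by (simp add: vec_eq_iff forall_3 axis_def)
  ultimately show ?thesis
    by (simp only:)
qed

text \<open>Makes Fubini available on \<open>real^3\<close>: under this identification boxes
  correspond to products of a plane box and an interval, and boxes determine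
  \<open>lborel\<close>.\<close>

lemma distr_lborel_vector3:
  "distr (lborel \<Otimes>\<^sub>M lborel) borel (\<lambda>(x::real^2, z::real). vector [x$1, x$2, z] :: real^3) = lborel"
    (is "distr _ _ ?f = _")
proof (rule lborel_eqI[symmetric])
  fix l u :: "real^3"
  assume lu: "\<And>b. b \<in> Basis \<Longrightarrow> l \<bullet> b \<le> u \<bullet> b"
  have cart: "l $ i \<le> u $ i" for i
    using lu[of "axis i 1"] by (simp add: inner_axis)
  have "continuous_on UNIV ?f"
    unfolding case_prod_beta by (intro continuous_intros continuous_on_vector_3)
  then have [measurable]: "?f \<in> borel_measurable (lborel \<Otimes>\<^sub>M lborel)"
    by (simp add: lborel_prod borel_measurable_continuous_onI)
  let ?P = "\<lambda>w::real^3. vector [w$1, w$2] :: real^2"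
  have cart2: "\<forall>i. ?P l $ i \<le> ?P u $ i"
    by (simp add: forall_2 cart)
  have "?f -` box l u = box (?P l) (?P u) \<times> box (l$3) (u$3)"
    by (auto simp: mem_box_cart forall_2 forall_3)
  then have "emeasure (distr (lborel \<Otimes>\<^sub>M lborel) borel ?f) (box l u)
      = emeasure lborel (box (?P l) (?P u)) * emeasure lborel (box (l$3) (u$3))"
    by (simp add: emeasure_distr space_pair_measure lborel.emeasure_pair_measure_Times)
  also have "emeasure lborel (box (?P l) (?P u)) = (\<Prod>b\<in>Basis. (?P u - ?P l) \<bullet> b)"
    using cart2 by (intro emeasure_lborel_box) (auto simp: Basis_vec_def inner_axis)
  also have "\<dots> * emeasure lborel (box (l$3) (u$3)) = (\<Prod>b\<in>Basis. (u - l) \<bullet> b)"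
  proof -
    have "(\<Prod>b\<in>Basis. (u - l) \<bullet> b) = (\<Prod>b\<in>Basis. (?P u - ?P l) \<bullet> b) * (u$3 - l$3)"
      unfolding prod_Basis_cart UNIV_2 UNIV_3 by (simp add: mult.assoc)
    \<comment> \<open>\<open>ennreal\<close> is multiplicative only on nonnegative factors.\<close>
    moreover have "0 \<le> (\<Prod>b\<in>Basis. (?P u - ?P l) \<bullet> b)"
      unfolding prod_Basis_cart using cart2 by (intro prod_nonneg) simp
    moreover have "emeasure lborel (box (l$3) (u$3)) = ennreal (u$3 - l$3)"
      using cart by simp
    ultimately show ?thesis
      using cart by (simp only: ennreal_mult diff_ge_0_iff_ge)
  qed
  finally show "emeasure (distr (lborel \<Otimes>\<^sub>M lborel) borel ?f) (box l u) = (\<Prod>b\<in>Basis. (u - l) \<bullet> b)" .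
qed simp

section \<open>Integrals of continuous functions with compact support\<close>

lemma integrable_lborel_compact_support:
  fixes f :: "'a::euclidean_space \<Rightarrow> 'b::{banach, second_countable_topology}"
  assumes "continuous_on UNIV f" "compact K" "\<And>x. x \<notin> K \<Longrightarrow> f x = 0"
  shows "integrable lborel f"
proof -
  have "f = (\<lambda>x. indicator K x *\<^sub>R f x)"
    using assms(3) by (auto simp: fun_eq_iff indicator_def)
  then show ?thesis
    using borel_integrable_compact[OF assms(2) continuous_on_subset[OF assms(1)]] by auto
qed

text \<open>If the integral were zero, f would vanish almost everywhere, but the set where f is
  nonzero is open and contains a, hence is not negligible. This makes the mass in the denominators
  of the centres nonzero.\<close>

lemma integral_lborel_pos:
  fixes f :: "'a::euclidean_space \<Rightarrow> real"
  assumes "continuous_on UNIV f" "integrable lborel f" "\<And>x. f x \<ge> 0" "f a \<noteq> 0"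
  shows "(LINT x|lborel. f x) > 0"
proof -
  have "(LINT x|lborel. f x) \<noteq> 0"
  proof
    assume "(LINT x|lborel. f x) = 0"
    then have "AE x in lborel. f x = 0"
      using integral_nonneg_eq_0_iff_AE[OF assms(2)] assms(3) by auto
    then have "{x. f x \<noteq> 0} \<in> null_sets lborel"
      using assms(2) by (subst AE_iff_null_sets) auto
    then have "negligible {x. f x \<noteq> 0}"
      by (simp add: negligible_iff_null_sets null_sets_completionI)
    moreover have "open {x. f x \<noteq> 0}"
      using assms(1) by (intro open_Collect_neq) auto
    ultimately show False
      using open_not_negligible assms(4) by blast
  qed
  then show ?thesis
    using assms(3) by (simp add: order.not_eq_order_implies_strict)
qed

section \<open>Differentiation of the Fourier integral\<close>

lemma has_derivative_quadratic_remainder: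
  fixes f :: "'a::real_normed_vector \<Rightarrow> 'b::real_normed_vector"
  assumes "bounded_linear D" and B: "\<And>h. norm (f (x + h) - f x - D h) \<le> B * (norm h)\<^sup>2"
  shows "(f has_derivative D) (at x)"
  unfolding has_derivative_at
proof
  have lim: "((\<lambda>h::'a. B * norm h) \<longlongrightarrow> 0) (at 0)"
    by (intro tendsto_mult_right_zero tendsto_norm_zero tendsto_ident_at)
  \<comment> \<open>At h = 0 both sides are 0, since division by zero yields 0.\<close>
  have "norm (norm (f (x + h) - f x - D h) / norm h) \<le> B * norm h" for h
    using B[of h] by (cases "h = 0") (auto simp: divide_simps power2_eq_square mult.assoc)
  then show "((\<lambda>h. norm (f (x + h) - f x - D h) / norm h) \<longlongrightarrow> 0) (at 0)"
    by (intro Lim_null_comparison[OF _ lim] always_eventually allI)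
qed fact

text \<open>Differentiation under the integral sign by an explicit bound: the pointwise Taylor
  remainder of the exponential is quadratic in h, with a factor that is integrable against f because
  of the compact support.\<close>

lemma has_derivative_fourier_integral:
  fixes f :: "'a::euclidean_space \<Rightarrow> complex"
  assumes f: "continuous_on UNIV f" "compact K" "\<And>y. y \<notin> K \<Longrightarrow> f y = 0"
  shows "((\<lambda>\<xi>. LINT y|lborel. f y * exp (- (\<i> * of_real (\<xi> \<bullet> (y - c))))) has_derivative
    (\<lambda>h. LINT y|lborel. f y * (exp (- (\<i> * of_real (\<xi> \<bullet> (y - c)))) * (- (\<i> * of_real (h \<bullet> (y - c)))))))
    (at \<xi>)" (is "(?F has_derivative ?D) _")
proof -
  let ?e = "\<lambda>\<xi> y. exp (- (\<i> * of_real (\<xi> \<bullet> (y - c)))) :: complex"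
  let ?l = "\<lambda>h y. - (\<i> * of_real (h \<bullet> (y - c))) :: complex"
  \<comment> \<open>The second absolute moment of f about c, which is the integrated Taylor
    constant.\<close>
  define B where "B = (LINT y|lborel. norm (f y) * (norm (y - c))\<^sup>2)"
  have int: "integrable lborel (\<lambda>y. f y * g y)" if "continuous_on UNIV g" for g
    by (rule integrable_lborel_compact_support[OF _ f(2)]) (auto intro!: continuous_intros f that simp: f(3))
  have intB: "integrable lborel (\<lambda>y. norm (f y) * (norm (y - c))\<^sup>2)"
    by (rule integrable_lborel_compact_support[OF _ f(2)]) (auto intro!: continuous_intros f simp: f(3))
  have i1: "integrable lborel (\<lambda>y. f y * ?e \<xi> y)" for \<xi>
    by (intro int continuous_intros)
  have i2: "integrable lborel (\<lambda>y. f y * (?e \<xi> y * ?l h y))" for \<xi> h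
    by (intro int continuous_intros)
  have lin: "linear ?D"
  proof (rule linearI)
    show "?D (h + k) = ?D h + ?D k" for h k
      by (subst Bochner_Integration.integral_add[symmetric, OF i2 i2])
        (simp add: inner_add_left algebra_simps)
    show "?D (r *\<^sub>R h) = r *\<^sub>R ?D h" for r h
      by (subst integral_scaleR_right[symmetric]) (simp add: scaleR_conv_of_real mult_ac)
  qed
  have bound: "norm (?F (\<xi> + h) - ?F \<xi> - ?D h) \<le> B * (norm h)\<^sup>2" for h
  proof -
    have eq: "?F (\<xi> + h) - ?F \<xi> - ?D h = (LINT y|lborel. f y * ?e (\<xi> + h) y - f y * ?e \<xi> y - f y * (?e \<xi> y * ?l h y))"
      by (simp only: Bochner_Integration.integral_diff i1 i2 Bochner_Integration.integrable_diff)
    have "norm (?F (\<xi> + h) - ?F \<xi> - ?D h) \<le> (LINT y|lborel. norm (f y) * (norm (y - c))\<^sup>2 * (norm h)\<^sup>2)"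
      unfolding eq
    proof (rule Bochner_Integration.integral_norm_bound_integral)
      fix y
      \<comment> \<open>\<open>?l h y\<close> is purely imaginary, so the growth factor in the
        Taylor bound, the exponential of the absolute real part, equals 1.\<close>
      have "norm (exp (?l h y) - (1 + ?l h y)) \<le> (norm (?l h y))\<^sup>2"
        using Taylor_exp[of "?l h y" 1] by (simp add: power2_eq_square)
      also have "\<dots> \<le> (norm h * norm (y - c))\<^sup>2"
        by (rule power_mono) (simp_all add: norm_mult Cauchy_Schwarz_ineq2)
      finally have le: "norm (exp (?l h y) - (1 + ?l h y)) \<le> (norm (y - c))\<^sup>2 * (norm h)\<^sup>2"
        by (simp add: power_mult_distrib mult.commute)
      \<comment> \<open>Factoring out \<open>?e \<xi> y\<close>, of modulus 1, reduces the remainder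
        at \<xi> to the remainder at 0.\<close>
      have "f y * ?e (\<xi> + h) y - f y * ?e \<xi> y - f y * (?e \<xi> y * ?l h y)
          = f y * ?e \<xi> y * (exp (?l h y) - (1 + ?l h y))"
        by (simp add: algebra_simps inner_add_left exp_add[symmetric])
      then have "norm (f y * ?e (\<xi> + h) y - f y * ?e \<xi> y - f y * (?e \<xi> y * ?l h y))
          = norm (f y) * norm (exp (?l h y) - (1 + ?l h y))"
        by (simp only: norm_mult norm_exp_eq_Re) simp
      also have "\<dots> \<le> norm (f y) * ((norm (y - c))\<^sup>2 * (norm h)\<^sup>2)"
        by (rule mult_left_mono[OF le]) simp
      finally show "norm (f y * ?e (\<xi> + h) y - f y * ?e \<xi> y - f y * (?e \<xi> y * ?l h y))
          \<le> norm (f y) * (norm (y - c))\<^sup>2 * (norm h)\<^sup>2"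
        by (simp only: mult.assoc)
    next
      show "integrable lborel (\<lambda>y. f y * ?e (\<xi> + h) y - f y * ?e \<xi> y - f y * (?e \<xi> y * ?l h y))"
        by (intro Bochner_Integration.integrable_diff i1 i2)
      show "integrable lborel (\<lambda>y. norm (f y) * (norm (y - c))\<^sup>2 * (norm h)\<^sup>2)"
        by (intro integrable_mult_left intB)
    qed
    also have "\<dots> = B * (norm h)\<^sup>2"
      unfolding B_def by (rule Bochner_Integration.integral_mult_left) (rule intB)
    finally show ?thesis .
  qed
  show ?thesis
  proof (rule has_derivative_quadratic_remainder[of ?D ?F \<xi> B])
    show "bounded_linear ?D"
      by (rule linear_conv_bounded_linear[THEN iffD1, OF lin])
    show "norm (?F (\<xi> + h) - ?F \<xi> - ?D h) \<le> B * (norm h)\<^sup>2" for h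
      by (rule bound)
  qed
qed

section \<open>The horizontal plane in space\<close>

definition proj_plane :: "real^3 \<Rightarrow> real^2" where
  "proj_plane z = vector [z $ 1, z $ 2]"

definition embed_plane :: "real^2 \<Rightarrow> real^3" where
  "embed_plane k = vector [k $ 1, k $ 2, 0]"

lemma proj_plane_vector [simp]: "proj_plane (vector [x $ 1, x $ 2, z]) = x"
  by (simp add: proj_plane_def vec_eq_iff forall_2)

text \<open>Adjointness of projection and embedding; it turns a plane frequency into a horizontal
  frequency in space.\<close>

lemma inner_proj_plane: "k \<bullet> proj_plane z = embed_plane k \<bullet> z"
  by (simp add: proj_plane_def embed_plane_def inner_vec_def sum_2 sum_3)

lemma linear_proj_plane: "linear proj_plane"
  by (rule linearI) (simp_all add: proj_plane_def vec_eq_iff forall_2)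

lemma linear_embed_plane: "linear embed_plane"
  by (rule linearI) (simp_all add: embed_plane_def vec_eq_iff forall_3)

lemma continuous_on_proj_plane [continuous_intros]:
  "continuous_on S f \<Longrightarrow> continuous_on S (\<lambda>x. proj_plane (f x))"
  by (rule bounded_linear.continuous_on[OF linear_conv_bounded_linear[THEN iffD1, OF linear_proj_plane]])

lemma continuous_on_matrix_vector_mult [continuous_intros]:
  fixes A :: "real^'n^'m"
  shows "continuous_on S f \<Longrightarrow> continuous_on S (\<lambda>x. A *v f x)"
  by (rule bounded_linear.continuous_on[OF matrix_vector_mul_bounded_linear])

section \<open>Moments and Fourier transform of the attenuation map\<close>

text \<open>One change of variables serves three purposes: g is later the constant 1 (mass), the
  identity (centre) and an exponential (Fourier transform). Fubini merges the integral along the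
  third axis with the plane integral, and the rigid motion is then substituted away.\<close>

lemma integral_attenuation_scaleR:
  fixes g :: "real^2 \<Rightarrow> 'b::{banach, second_countable_topology}"
  assumes u: "continuous_on UNIV u" "compact K" "\<And>x. x \<notin> K \<Longrightarrow> u x = 0"
    and orth: "orthogonal_matrix (R t)"
    and g: "continuous_on UNIV g"
  defines "c \<equiv> center3 u"
  shows "(LINT x|lborel. attenuation u T R t x *\<^sub>R g x) =
    (LINT y|lborel. u y *\<^sub>R g (proj_plane (c - T t + transpose (R t) *v (y - c))))"
proof -
  define m where "m = (\<lambda>z. c + R t *v (z - c + T t))"
  \<comment> \<open>The inverse of the motion \<open>m\<close>, by orthogonality of
    \<open>R t\<close>.\<close>
  define i where "i = (\<lambda>y. c - T t + transpose (R t) *v (y - c))"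
  have im: "i (m z) = z" for z
    using orth unfolding orthogonal_matrix_def i_def m_def
    by (simp add: matrix_vector_mul_assoc del: transpose_matrix_vector)
  have cont_m: "continuous_on UNIV m" and cont_i: "continuous_on UNIV i"
    unfolding m_def i_def by (intro continuous_intros)+
  have cu: "continuous_on S (\<lambda>x. u (f x))" if "continuous_on S f" for f :: "'c::topological_space \<Rightarrow> _" and S
    using continuous_on_compose2[OF u(1) that] by simp
  have cg: "continuous_on S (\<lambda>x. g (f x))" if "continuous_on S f" for f :: "'c::topological_space \<Rightarrow> _" and S
    using continuous_on_compose2[OF g that] by simp
  let ?F = "\<lambda>y. u y *\<^sub>R g (proj_plane (i y))"
  let ?G = "\<lambda>z. u (m z) *\<^sub>R g (proj_plane z)"
  let ?v = "\<lambda>(x::real^2, z::real). vector [x$1, x$2, z] :: real^3"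
  have vanish: "u (m z) = 0" if "z \<notin> i ` K" for z
    using that im u(3) by (metis imageI)
  have compact: "compact (i ` K)"
    by (rule compact_continuous_image[OF continuous_on_subset[OF cont_i] u(2)]) simp
  have cont_F: "continuous_on UNIV ?F"
    by (intro continuous_intros cu cg cont_i)
  have cont_G: "continuous_on UNIV ?G"
    by (intro continuous_intros cu cg cont_m)
  \<comment> \<open>Brings \<open>m\<close> into the form of a linear map followed by a
    translation.\<close>
  have "m = (\<lambda>z. (c + R t *v (T t - c)) + R t *v z)"
    by (simp add: m_def fun_eq_iff algebra_simps)
  then have "distr lborel borel m = lborel"
    using distr_lborel_rigid_motion[OF orth] by simp
  then have "(LINT y|lborel. ?F y) = (LINT y|(distr lborel borel m). ?F y)"
    by simp
  also have "\<dots> = (LINT z|lborel. ?G z)"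
    using cont_m cont_F by (subst integral_distr) (auto simp: im borel_measurable_continuous_onI)
  finally have 1: "(LINT y|lborel. ?F y) = (LINT z|lborel. ?G z)" .
  have cont_v: "continuous_on UNIV ?v"
    unfolding case_prod_beta by (intro continuous_intros)
  have meas_v: "?v \<in> lborel \<Otimes>\<^sub>M lborel \<rightarrow>\<^sub>M borel"
    using cont_v by (simp add: lborel_prod borel_measurable_continuous_onI)
  have meas_G: "?G \<in> borel_measurable borel"
    using cont_G by (rule borel_measurable_continuous_onI)
  have "integrable lborel ?G"
    by (rule integrable_lborel_compact_support[OF cont_G compact]) (simp add: vanish)
  then have "integrable (distr (lborel \<Otimes>\<^sub>M lborel) borel ?v) ?G"
    by (simp add: distr_lborel_vector3)
  then have int: "integrable (lborel \<Otimes>\<^sub>M lborel) (\<lambda>p. ?G (?v p))"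
    by (simp only: integrable_distr_eq[OF meas_v meas_G])
  have "(LINT z|lborel. ?G z) = (LINT p|(lborel \<Otimes>\<^sub>M lborel). ?G (?v p))"
    using integral_distr[OF meas_v meas_G] by (simp only: distr_lborel_vector3)
  also have "\<dots> = (LINT x|lborel. LINT z|lborel. ?G (?v (x, z)))"
    by (rule lborel_pair.integral_fst'[OF int, symmetric])
  also have "\<dots> = (LINT x|lborel. attenuation u T R t x *\<^sub>R g x)"
  proof (rule Bochner_Integration.integral_cong[OF refl])
    fix x :: "real^2"
    \<comment> \<open>Integrability along the vertical line allows the constant \<open>g x\<close>
      to leave the inner integral.\<close>
    have "integrable lborel (\<lambda>z. u (m (vector [x$1, x$2, z])))"
    proof (rule integrable_lborel_compact_support)
      show "continuous_on UNIV (\<lambda>z. u (m (vector [x$1, x$2, z])))"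
        by (intro cu continuous_on_compose2[OF cont_m] continuous_intros) simp
      show "compact ((\<lambda>w. w $ 3) ` i ` K)"
        by (intro compact_continuous_image compact continuous_intros)
      show "u (m (vector [x$1, x$2, z])) = 0" if "z \<notin> (\<lambda>w. w $ 3) ` i ` K" for z
        using that by (intro vanish) (metis imageI vector_3(3))
    qed
    then show "(LINT z|lborel. ?G (?v (x, z))) = attenuation u T R t x *\<^sub>R g x"
      by (simp add: attenuation_def m_def c_def)
  qed
  finally show ?thesis
    using 1 unfolding i_def by simp
qed

text \<open>The projected position is affine in \<open>y - center3 u\<close>. Its linear part
  integrates to zero, as the first moment about the centre vanishes, so the rotation leaves no
  trace.\<close>

lemma center2_eq:
  assumes u: "continuous_on UNIV u" "compact K" "\<And>x. x \<notin> K \<Longrightarrow> u x = 0"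
    and nz: "(LINT x|lborel. u x) \<noteq> 0"
    and orth: "orthogonal_matrix (R t)"
  shows "center2 u T R t = proj_plane (center3 u - T t)"
proof -
  define c where "c = center3 u"
  define M where "M = (LINT x|lborel. u x)"
  define L where "L = (\<lambda>y. proj_plane (transpose (R t) *v y))"
  have linL: "linear L"
    unfolding L_def by (rule linear_compose[OF matrix_vector_mul_linear linear_proj_plane, unfolded comp_def])
  have int: "integrable lborel (\<lambda>y. u y *\<^sub>R f y)" if "continuous_on UNIV f"
    for f :: "real^3 \<Rightarrow> 'c::{banach, second_countable_topology}"
    by (rule integrable_lborel_compact_support[OF _ u(2)]) (auto intro!: continuous_intros u that simp: u(3))
  have intu: "integrable lborel u"
    by (rule integrable_lborel_compact_support[OF u])
  have mass: "(LINT x|lborel. attenuation u T R t x) = M"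
    using integral_attenuation_scaleR[where R = R and T = T and t = t and g = "\<lambda>_. 1::real", OF u orth]
    by (simp add: M_def)
  have "(LINT y|lborel. u y *\<^sub>R (y - c)) = (LINT y|lborel. u y *\<^sub>R y) - M *\<^sub>R c"
    unfolding M_def scaleR_diff_right
    by (subst Bochner_Integration.integral_diff) (auto simp: intu intro!: int continuous_intros)
  also have "\<dots> = 0"
    using nz by (simp add: c_def center3_def M_def)
  finally have zero: "(LINT y|lborel. u y *\<^sub>R (y - c)) = 0" .
  have "(LINT x|lborel. attenuation u T R t x *\<^sub>R x) =
      (LINT y|lborel. u y *\<^sub>R proj_plane (c - T t + transpose (R t) *v (y - c)))"
    unfolding c_def by (rule integral_attenuation_scaleR[where R = R and g = "\<lambda>x. x", OF u orth continuous_on_id])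
  \<comment> \<open>Moving the weight \<open>u y\<close> inside the linear map lets \<open>L\<close>
    be exchanged with the integral.\<close>
  also have "\<dots> = (LINT y|lborel. u y *\<^sub>R proj_plane (c - T t) + L (u y *\<^sub>R (y - c)))"
    by (simp only: L_def linear_add[OF linear_proj_plane] linear_cmul[OF linear_proj_plane]
        matrix_vector_mult_scaleR scaleR_add_right)
  also have "\<dots> = M *\<^sub>R proj_plane (c - T t) + L (LINT y|lborel. u y *\<^sub>R (y - c))"
  proof (subst Bochner_Integration.integral_add)
    show "integrable lborel (\<lambda>y. L (u y *\<^sub>R (y - c)))"
      by (intro integrable_bounded_linear[OF linear_conv_bounded_linear[THEN iffD1, OF linL]] int continuous_intros)
    have "(LINT y|lborel. L (u y *\<^sub>R (y - c))) = L (LINT y|lborel. u y *\<^sub>R (y - c))"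
      by (intro integral_bounded_linear[OF linear_conv_bounded_linear[THEN iffD1, OF linL]] int continuous_intros)
    then show "(LINT y|lborel. u y *\<^sub>R proj_plane (c - T t)) + (LINT y|lborel. L (u y *\<^sub>R (y - c))) =
        M *\<^sub>R proj_plane (c - T t) + L (LINT y|lborel. u y *\<^sub>R (y - c))"
      using intu by (simp add: M_def)
  qed (use intu in auto)
  finally have "(LINT x|lborel. attenuation u T R t x *\<^sub>R x) = M *\<^sub>R proj_plane (c - T t)"
    by (simp add: zero linear_0[OF linL])
  then show ?thesis
    using nz by (simp add: center2_def mass c_def M_def)
qed

text \<open>The phase splits into a part constant in y and a part at the rotated frequency. By
  \<open>center2_eq\<close> the constant part is cancelled by the factor
  \<open>exp (\<i> * complex_of_real (k \<bullet> center2 u T R t))\<close>.\<close>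

lemma reduced_attenuation_eq:
  assumes u: "continuous_on UNIV u" "compact K" "\<And>x. x \<notin> K \<Longrightarrow> u x = 0"
    and nz: "(LINT x|lborel. u x) \<noteq> 0"
    and orth: "orthogonal_matrix (R t)"
  shows "reduced_attenuation u T R t k = complex_of_real (1 / (2 * pi)) * (LINT y|lborel.
    of_real (u y) * exp (- (\<i> * of_real ((R t *v embed_plane k) \<bullet> (y - center3 u)))))"
proof -
  let ?c = "center3 u"
  let ?p = "k \<bullet> proj_plane (?c - T t)"
  let ?e = "\<lambda>y. exp (- (\<i> * complex_of_real ((R t *v embed_plane k) \<bullet> (y - ?c))))"
  \<comment> \<open>Two adjoints move onto k: \<open>embed_plane\<close> for the projection, then
    \<open>R t\<close> for its transpose.\<close>
  have phase: "k \<bullet> proj_plane (?c - T t + transpose (R t) *v (y - ?c)) =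
      ?p + (R t *v embed_plane k) \<bullet> (y - ?c)" for y
    by (simp add: linear_add[OF linear_proj_plane] inner_add_right inner_proj_plane inner_commute
        flip: dot_lmul_matrix)
  have "(LINT x|lborel. attenuation u T R t x *\<^sub>R exp (- (\<i> * complex_of_real (k \<bullet> x)))) =
      (LINT y|lborel. u y *\<^sub>R exp (- (\<i> * complex_of_real
        (k \<bullet> proj_plane (?c - T t + transpose (R t) *v (y - ?c))))))"
  proof (rule integral_attenuation_scaleR[where R = R and g = "\<lambda>x. exp (- (\<i> * complex_of_real (k \<bullet> x)))", OF u(1,2)])
    show "u x = 0" if "x \<notin> K" for x
      using that by (rule u(3))
    show "continuous_on UNIV (\<lambda>x. exp (- (\<i> * complex_of_real (k \<bullet> x))))"
      by (intro continuous_intros)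
  qed (rule orth)
  also have "\<dots> = (LINT y|lborel. exp (- (\<i> * of_real ?p)) * (of_real (u y) * ?e y))"
    unfolding phase by (simp add: scaleR_conv_of_real exp_add[symmetric] algebra_simps exp_diff)
  also have "\<dots> = exp (- (\<i> * of_real ?p)) * (LINT y|lborel. of_real (u y) * ?e y)"
    by (rule integral_mult_right_zero)
  finally show ?thesis
    by (simp add: reduced_attenuation_def fourier2_def center2_eq[where R = R, OF u nz orth] scaleR_conv_of_real
        exp_minus field_simps)
qed

section \<open>Chain rule in frequency and in time\<close>

theorem proposition3p7:
  fixes u :: "real^3 \<Rightarrow> real"
    and T :: "real \<Rightarrow> real^3"
    and R :: "real \<Rightarrow> real^3^3"
    and \<omega> :: "real \<Rightarrow> real^3"
    and \<alpha> \<phi> \<omega>3 :: "real \<Rightarrow> real"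
    and v :: "real \<Rightarrow> real^2"
  assumes "u \<in> C_c_plus"
    and "continuous_on UNIV T"
    and "Ck 2 R" and "\<forall>t. rotation_matrix (R t)"
    and "Ck 1 \<omega>" and "is_angular_velocity R \<omega>"
    and "cylindrical_coordinates \<omega> \<alpha> v \<phi> \<omega>3"
  shows "\<forall>t \<mu>. \<alpha> t \<noteq> 0 \<longrightarrow>
    reduced_attenuation u T R t differentiable (at (\<mu> *\<^sub>R v t)) \<and>
    ((\<lambda>s. reduced_attenuation u T R s (\<mu> *\<^sub>R v t)) has_vector_derivative
      \<omega>3 t *\<^sub>R D1 (reduced_attenuation u T R) t (\<mu> *\<^sub>R v t) (\<mu> *\<^sub>R perp (v t))) (at t)"
proof (intro allI impI)
  fix t \<mu>
  have u: "continuous_on UNIV u" "\<And>x. u x \<ge> 0"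
    and K: "compact (closure (support_on UNIV u))" and "support_on UNIV u \<noteq> {}"
    using assms(1) by (auto simp: C_c_plus_def)
  then obtain a where a: "u a \<noteq> 0"
    by (auto simp: support_on_def)
  have vanish: "u x = 0" if "x \<notin> closure (support_on UNIV u)" for x
    using that closure_subset[of "support_on UNIV u"] by (auto simp: support_on_def)
  have nz: "(LINT x|lborel. u x) \<noteq> 0"
    using integral_lborel_pos[OF u(1) integrable_lborel_compact_support[OF u(1) K vanish] u(2) a] by simp
  define \<Phi> where "\<Phi> = (\<lambda>\<xi>. complex_of_real (1 / (2 * pi)) * (LINT y|lborel.
    of_real (u y) * exp (- (\<i> * of_real (\<xi> \<bullet> (y - center3 u))))))"
  have orth: "orthogonal_matrix (R s)" for s
    using assms(4) by (simp add: rotation_matrix_def)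
  have J: "reduced_attenuation u T R s k = \<Phi> (R s *v embed_plane k)" for s k
    unfolding \<Phi>_def by (rule reduced_attenuation_eq[where R = R, OF u(1) K vanish nz orth])
  define e where "e = embed_plane (\<mu> *\<^sub>R v t)"
  \<comment> \<open>The same derivative \<open>D\<close> at this point serves both chain rules; its
    linearity is what the later steps use, so its integral formula stays hidden.\<close>
  have "\<exists>D. (\<Phi> has_derivative D) (at (R t *v e))"
    unfolding \<Phi>_def
    by (rule exI, rule has_derivative_mult_right, rule has_derivative_fourier_integral[OF _ K])
      (use u vanish in \<open>simp_all add: continuous_on_of_real\<close>)
  then obtain D where D: "(\<Phi> has_derivative D) (at (R t *v e))" ..
  have linD: "linear D"
    using D by (rule has_derivative_linear)

  have "linear (\<lambda>k. R t *v embed_plane k)"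
    by (rule linear_compose[OF linear_embed_plane matrix_vector_mul_linear, unfolded comp_def])
  then have "((\<lambda>k. R t *v embed_plane k) has_derivative (\<lambda>k. R t *v embed_plane k)) (at (\<mu> *\<^sub>R v t))"
    by (intro bounded_linear_imp_has_derivative linear_conv_bounded_linear[THEN iffD1])
  from has_derivative_compose[OF this, of \<Phi> D] D
  have space: "(reduced_attenuation u T R t has_derivative (\<lambda>k. D (R t *v embed_plane k))) (at (\<mu> *\<^sub>R v t))"
    unfolding J[abs_def] e_def by simp

  define R' where "R' = vector_derivative R (at t)"
  have "R differentiable (at t)"
    using assms(3) by (simp add: numeral_2_eq_2)
  then have R': "(R has_vector_derivative R') (at t)"
    by (simp add: R'_def vector_derivative_works)
  \<comment> \<open>Evaluation at a fixed vector is linear in the matrix, so it commutes with the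
    time derivative.\<close>
  have lin: "linear (\<lambda>A. A *v e)" for e :: "real^3"
    by (rule linearI) (simp_all add: matrix_vector_mult_add_rdistrib scaleR_matrix_vector_assoc)
  have "((\<lambda>s. R s *v e) has_vector_derivative R' *v e) (at t)"
    by (rule bounded_linear.has_vector_derivative[OF linear_conv_bounded_linear[THEN iffD1, OF lin] R'])
  then have "((\<lambda>s. R s *v e) has_derivative (\<lambda>h. h *\<^sub>R (R' *v e))) (at t)"
    by (simp add: has_vector_derivative_def)
  from has_derivative_compose[OF this D]
  have time: "((\<lambda>s. reduced_attenuation u T R s (\<mu> *\<^sub>R v t)) has_vector_derivative D (R' *v e)) (at t)"
    unfolding J has_vector_derivative_def e_def by (simp add: linear_cmul[OF linD])

  have "transpose (R t) *v (R' *v e) = cross3 (\<omega> t) e"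
    using assms(6) unfolding is_angular_velocity_def R'_def by (metis matrix_vector_mul_assoc)
  \<comment> \<open>Applying \<open>R t\<close> cancels the transpose and isolates
    \<open>R' *v e\<close>.\<close>
  then have "R t *v (transpose (R t) *v (R' *v e)) = R t *v cross3 (\<omega> t) e"
    by (rule arg_cong)
  then have "R' *v e = R t *v cross3 (\<omega> t) e"
    using orth[of t] unfolding orthogonal_matrix_def
    by (simp add: matrix_vector_mul_assoc matrix_mul_assoc del: transpose_matrix_vector)
  \<comment> \<open>The horizontal part of \<omega> is parallel to \<open>e\<close>, so the third
    component of the product vanishes; the vertical part acts on \<open>e\<close> as a quarter turn
    scaled by \<omega>3.\<close>
  also have "cross3 (\<omega> t) e = \<omega>3 t *\<^sub>R embed_plane (\<mu> *\<^sub>R perp (v t))"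
  proof -
    have "\<omega> t = vector [\<alpha> t * v t $ 1, \<alpha> t * v t $ 2, \<omega>3 t]"
      using assms(7) unfolding cylindrical_coordinates_def by blast
    then show ?thesis
      by (simp add: cross3_def e_def embed_plane_def perp_def vec_eq_iff forall_3)
  qed
  finally have "D (R' *v e) = \<omega>3 t *\<^sub>R D (R t *v embed_plane (\<mu> *\<^sub>R perp (v t)))"
    by (simp add: matrix_vector_mult_scaleR linear_cmul[OF linD])
  \<comment> \<open>By uniqueness of the Frechet derivative, \<open>space\<close> evaluates
    \<open>D1\<close> as \<open>D\<close> at the rotated embedded vector, matching the time
    derivative.\<close>
  with time space show "reduced_attenuation u T R t differentiable (at (\<mu> *\<^sub>R v t)) \<and>
    ((\<lambda>s. reduced_attenuation u T R s (\<mu> *\<^sub>R v t)) has_vector_derivative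
      \<omega>3 t *\<^sub>R D1 (reduced_attenuation u T R) t (\<mu> *\<^sub>R v t) (\<mu> *\<^sub>R perp (v t))) (at t)"
    by (auto simp: D1_def differentiable_def simp flip: frechet_derivative_at[OF space])
qed

end
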